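(* There exist a positive integer $n$ and points $x_1,\dots,x_n\in[0,1]$ (not necessarily distinct) such that $$E(x_1, \dots, x_n) \geq \frac{n}{100}$$ and such that, for all $0 \leq x \leq 1$, $$E(x_1, \dots, x_n, x) \geq E(x_1, \dots, x_n) + \frac{1}{10}.$$
   Context: For $N\ge 1$ and points $y_1,\dots,y_N\in[0,1]$ the energy is $$E(y_1,\dots,y_N) = \min_{\pi\in S_N}\sum_{i=1}^{N}\left|y_{\pi(i)}-\frac{i}{N}\right|,$$ where $\pi$ ranges over all permutations of $\{1,\dots,N\}$. In particular $E(x_1,\dots,x_n,x)$ is the energy of $n+1$ points, with targets $i/(n+1)$. *)

theory Defs
  imports Complex_Main "HOL-Combinatorics.Permutations"
begin

(* Only the values y 1, ..., y N matter. The minimum is over a finite nonempty set. *)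
definition energy :: "nat \<Rightarrow> (nat \<Rightarrow> real) \<Rightarrow> real" where
  "energy N y =
    Min ((\<lambda>\<pi>. \<Sum>i = 1..N. \<bar>y (\<pi> i) - real i / real N\<bar>) ` {\<pi>. \<pi> permutes {1..N}})"

end

theory Submission
  imports Defs
begin

text \<open>Already \<open>n = 2\<close> suffices: for the points \<open>12/25\<close> and \<open>1\<close> the energy is \<open>1/50\<close>.
  With a third point \<open>t\<close>, the point \<open>12/25\<close> must be matched to a target in
  \<open>{1/3, 2/3, 1}\<close>, all at distance more than \<open>1/50 + 1/10\<close>.\<close>

lemma energy_le:
  assumes "\<pi> permutes {1..N}"
  shows "energy N y \<le> (\<Sum>i = 1..N. \<bar>y (\<pi> i) - real i / real N\<bar>)"
  unfolding energy_def using assms by (intro Min_le) (auto simp: finite_permutations)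

text \<open>Every permutation pairs \<open>y k\<close> with some target, and that single term
  already bounds the sum of nonnegative terms from below.\<close>

lemma energy_ge_if_far:
  assumes "k \<in> {1..N}"
    and "\<And>i. i \<in> {1..N} \<Longrightarrow> c \<le> \<bar>y k - real i / real N\<bar>"
  shows "c \<le> energy N y"
proof -
  have "c \<le> (\<Sum>i = 1..N. \<bar>y (\<pi> i) - real i / real N\<bar>)" if \<pi>: "\<pi> permutes {1..N}" for \<pi>
  proof -
    obtain j where j: "j \<in> {1..N}" "\<pi> j = k"
      using assms(1) permutes_image[OF \<pi>] by (metis imageE)
    have "c \<le> \<bar>y (\<pi> j) - real j / real N\<bar>"
      using assms(2) j by simp
    also have "\<dots> \<le> (\<Sum>i = 1..N. \<bar>y (\<pi> i) - real i / real N\<bar>)"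
      using j(1) by (intro member_le_sum) auto
    finally show ?thesis .
  qed
  then show ?thesis
    unfolding energy_def
    by (subst Min_ge_iff) (auto simp: finite_permutations intro: permutes_id)
qed

theorem proposition2:
  shows "\<exists>(n::nat) (x::nat \<Rightarrow> real). n \<ge> 1
    \<and> (\<forall>i\<in>{1..n}. 0 \<le> x i \<and> x i \<le> 1)
    \<and> energy n x \<ge> real n / 100
    \<and> (\<forall>t::real. 0 \<le> t \<and> t \<le> 1 \<longrightarrow>
          energy (n + 1) (x(n + 1 := t)) \<ge> energy n x + 1 / 10)"
proof -
  \<comment> \<open>The value \<open>12 / 25\<close> is exactly \<open>2 / 100\<close> away from the
    target \<open>1 / 2\<close>, yet 11/75 > 3/25 away from \<open>1 / 3\<close>.\<close>
  define x :: "nat \<Rightarrow> real" where "x = (\<lambda>i. if i = 1 then 12 / 25 else 1)"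
  have two: "{1..2} = {1, 2::nat}" and three: "{1..3} = {1, 2, 3::nat}"
    by auto
  have lower: "1 / 50 \<le> energy 2 x"
    by (rule energy_ge_if_far[where k = 1], simp, unfold two) (auto simp: x_def)
  \<comment> \<open>The identity pairs the point \<open>1\<close> with the target \<open>1\<close>
    at no cost, leaving only the distance from \<open>12 / 25\<close> to
    \<open>1 / 2\<close>.\<close>
  have upper: "energy 2 x \<le> 1 / 50"
    using energy_le[OF permutes_id, of 2 x] unfolding two by (simp add: x_def)
  have "1 / 50 + 1 / 10 \<le> energy 3 (x(3 := t))" for t
    by (rule energy_ge_if_far[where k = 1], simp, unfold three) (auto simp: x_def)
  then have "energy 2 x + 1 / 10 \<le> energy (2 + 1) (x(2 + 1 := t))" for t
    using order_trans[OF add_right_mono[OF upper, of "1 / 10"]] by simp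
  with lower show ?thesis
    by (intro exI[of _ "2::nat"] exI[of _ x]) (simp add: x_def)
qed

end
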